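(* Let $A$ be a semiprime coherent quantale with reticulation $(L(A),\lambda_A)$. Then: (1) for every $p\in \mathrm{Spec}(A)$, $O(p^{\ast})=(O(p))^{\ast}$; (2) for every prime ideal $P$ of $L(A)$, $(O(P))_{\ast}=O(P_{\ast})$.
   Context: A quantale is a complete lattice $(A,\vee,\wedge,0,1)$ with an associative multiplication distributing over arbitrary joins in each variable. All quantales are assumed commutative and integral ($1$ is the multiplicative unit). $K(A)$ is the set of compact elements. $A$ is algebraic if every element is a join of compact elements; $A$ is coherent if it is algebraic, $1\in K(A)$ and $K(A)$ is closed under multiplication. An element $p<1$ is $m$-prime if $ab\le p$ implies $a\le p$ or $b\le p$; $\mathrm{Spec}(A)$ is the set of $m$-prime elements; $A$ is semiprime if $\bigwedge\mathrm{Spec}(A)=0$. The reticulation of a coherent quantale $A$ is the (unique up to isomorphism) bounded distributive lattice $L(A)$ together with a surjective map $\lambda_A:K(A)\to L(A)$ such that for all $a,b\in K(A)$: $\lambda_A(a\vee b)\le\lambda_A(a)\vee\lambda_A(b)$; $\lambda_A(ab)=\lambda_A(a)\wedge\lambda_A(b)$; $\lambda_A(a)\le\lambda_A(b)$ iff $a^n\le b$ for some integer $n\ge1$. For $a\in A$, $a^{\ast}=\{\lambda_A(c): c\in K(A),\ c\le a\}$, an ideal of $L(A)$; for an ideal $I$ of $L(A)$, $I_{\ast}=\bigvee\{c\in K(A):\lambda_A(c)\in I\}$. For $p\in \mathrm{Spec}(A)$, $p^{\ast}$ is a prime ideal of $L(A)$; for a prime ideal $P$ of $L(A)$, $P_{\ast}\in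 \mathrm{Spec}(A)$. For $a\in A$, $O(a)=\bigvee\{u\in A: uv=0\text{ for some } v\in A,\ v\not\le a\}$. For a prime ideal $P$ of a bounded distributive lattice $L$, $O(P)$ is the ideal $\{x\in L: x\wedge y=0\text{ for some } y\in L\setminus P\}$. *)

theory Defs
  imports Main
begin

(* Commutative integral quantales. The bottom element 0 of the quantale is
   bot (the multiplicative structure carries no constant 0); by commutativity
   one distributive law suffices. *)

class comm_integral_quantale = complete_lattice + comm_monoid_mult +
  assumes mult_Sup_distrib: "a * Sup S = (SUP s\<in>S. a * s)"
    and one_eq_top: "1 = top"

definition compact_elt :: "'a::complete_lattice \<Rightarrow> bool" where
  "compact_elt c \<longleftrightarrow> (\<forall>S. c \<le> Sup S \<longrightarrow> (\<exists>F. finite F \<and> F \<subseteq> S \<and> c \<le> Sup F))"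

definition compacts :: "'a::complete_lattice set" where
  "compacts = {c. compact_elt c}"

definition algebraic_lattice :: "'a::complete_lattice itself \<Rightarrow> bool" where
  "algebraic_lattice _ \<longleftrightarrow> (\<forall>a::'a. \<exists>S\<subseteq>compacts. a = Sup S)"

definition coherent_quantale :: "'a::comm_integral_quantale itself \<Rightarrow> bool" where
  "coherent_quantale T \<longleftrightarrow>
     algebraic_lattice T \<and> (1::'a) \<in> compacts \<and>
     (\<forall>a\<in>compacts. \<forall>b\<in>compacts. (a * b :: 'a) \<in> compacts)"

definition m_prime :: "'a::comm_integral_quantale \<Rightarrow> bool" where
  "m_prime p \<longleftrightarrow> p < 1 \<and> (\<forall>a b. a * b \<le> p \<longrightarrow> a \<le> p \<or> b \<le> p)"

definition Spec :: "'a::comm_integral_quantale set" where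
  "Spec = {p. m_prime p}"

definition semiprime_quantale :: "'a::comm_integral_quantale itself \<Rightarrow> bool" where
  "semiprime_quantale _ \<longleftrightarrow> Inf (Spec :: 'a set) = bot"

definition lattice_ideal :: "'l::{distrib_lattice,bounded_lattice} set \<Rightarrow> bool" where
  "lattice_ideal I \<longleftrightarrow> bot \<in> I \<and> (\<forall>x\<in>I. \<forall>y\<in>I. sup x y \<in> I) \<and> (\<forall>x\<in>I. \<forall>y. y \<le> x \<longrightarrow> y \<in> I)"

definition prime_lattice_ideal :: "'l::{distrib_lattice,bounded_lattice} set \<Rightarrow> bool" where
  "prime_lattice_ideal P \<longleftrightarrow>
     lattice_ideal P \<and> P \<noteq> UNIV \<and> (\<forall>x y. inf x y \<in> P \<longrightarrow> x \<in> P \<or> y \<in> P)"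

(* The reticulation map has domain compacts. It is modelled by a total function
   whose values outside compacts are unconstrained and never used. *)

definition reticulation ::
  "('a::comm_integral_quantale \<Rightarrow> 'l::{distrib_lattice,bounded_lattice}) \<Rightarrow> bool" where
  "reticulation lam \<longleftrightarrow>
     lam ` compacts = UNIV \<and>
     (\<forall>a\<in>compacts. \<forall>b\<in>compacts.
        lam (sup a b) \<le> sup (lam a) (lam b) \<and>
        lam (a * b) = inf (lam a) (lam b) \<and>
        (lam a \<le> lam b \<longleftrightarrow> (\<exists>n::nat\<ge>1. a ^ n \<le> b)))"

(* elt_to_ideal lam a is a^*, and ideal_to_elt lam I is I_*. *)

definition elt_to_ideal :: "('a::complete_lattice \<Rightarrow> 'l) \<Rightarrow> 'a \<Rightarrow> 'l set" where
  "elt_to_ideal lam a = {lam c | c. c \<in> compacts \<and> c \<le> a}"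

definition ideal_to_elt :: "('a::complete_lattice \<Rightarrow> 'l) \<Rightarrow> 'l set \<Rightarrow> 'a" where
  "ideal_to_elt lam I = Sup {c \<in> compacts. lam c \<in> I}"

definition quantale_O :: "'a::comm_integral_quantale \<Rightarrow> 'a" where
  "quantale_O a = Sup {u. \<exists>v. \<not> v \<le> a \<and> u * v = bot}"

definition lattice_O :: "'l::{distrib_lattice,bounded_lattice} set \<Rightarrow> 'l set" where
  "lattice_O P = {x. \<exists>y. y \<notin> P \<and> inf x y = bot}"

end

theory Submission
  imports Defs
begin

text \<open>
  For an m-prime \<open>p\<close> the elements \<open>u\<close> with \<open>u * v = 0\<close> for some \<open>v\<close> not below \<open>p\<close> form a directed
  set, since witnesses multiply. Hence a compact \<open>c\<close> lies below \<open>O(p)\<close> iff \<open>c * d = 0\<close> for some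
  compact \<open>d\<close> not below \<open>p\<close>. Semiprimeness excludes nonzero nilpotents, so the reticulation turns
  \<open>c * d = 0\<close> into the vanishing of the meet of the images of \<open>c\<close> and \<open>d\<close>. Both identities then
  hold because they hold on compact elements.
\<close>

lemma mult_sup_distrib:
  fixes a :: "'a::comm_integral_quantale"
  shows "a * sup b c = sup (a * b) (a * c)"
  using mult_Sup_distrib[of a "{b, c}"] by simp

lemma mult_mono_quantale:
  fixes a b c d :: "'a::comm_integral_quantale"
  assumes "a \<le> b" "c \<le> d"
  shows "a * c \<le> b * d"
proof -
  have "a * c \<le> a * d"
    using mult_sup_distrib[of a c d] assms(2) by (simp add: sup_absorb2 le_iff_sup)
  also have "\<dots> \<le> b * d"
    using mult_sup_distrib[of d a b] assms(1) by (simp add: sup_absorb2 le_iff_sup mult.commute)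
  finally show ?thesis .
qed

text \<open>Since \<open>bot\<close> is the empty join, this is distributivity over the empty
  family.\<close>

lemma mult_bot_quantale [simp]:
  fixes a :: "'a::comm_integral_quantale"
  shows "a * bot = bot" "bot * a = bot"
  using mult_Sup_distrib[of a "{}"] by (simp_all add: mult.commute)

lemma m_prime_power_le:
  assumes "m_prime p" "n \<ge> 1" "a ^ n \<le> p"
  shows "a \<le> p"
  using assms(2,3)
proof (induction n rule: dec_induct)
  case (step n)
  then show ?case using assms(1) unfolding m_prime_def by auto
qed simp

text \<open>A nilpotent element lies below every m-prime, hence below the meet of
  \<open>Spec\<close>, which is \<open>bot\<close>.\<close>

lemma power_eq_bot_semiprime:
  fixes a :: "'a::comm_integral_quantale"
  assumes "semiprime_quantale TYPE('a)" "n \<ge> 1" "a ^ n \<le> bot"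
  shows "a = bot"
proof -
  have "a \<le> p" if "p \<in> Spec" for p
    using that assms(2) order_trans[OF assms(3) bot_least] m_prime_power_le[of p n a]
    by (simp add: Spec_def)
  then have "a \<le> Inf Spec" by (rule Inf_greatest)
  then show ?thesis using assms(1) by (simp add: semiprime_quantale_def bot_unique)
qed

lemma bot_in_compacts: "bot \<in> compacts"
  unfolding compacts_def compact_elt_def by (auto intro!: exI[of _ "{}"])

lemma sup_in_compacts:
  assumes "a \<in> compacts" "b \<in> compacts"
  shows "sup a b \<in> compacts"
  unfolding compacts_def compact_elt_def
proof (intro CollectI allI impI)
  fix S assume "sup a b \<le> Sup S"
  then have "a \<le> Sup S" "b \<le> Sup S" by simp_all
  then obtain F G where "finite F" "F \<subseteq> S" "a \<le> Sup F" "finite G" "G \<subseteq> S" "b \<le> Sup G"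
    using assms unfolding compacts_def compact_elt_def by blast
  then show "\<exists>F. finite F \<and> F \<subseteq> S \<and> sup a b \<le> Sup F"
    by (intro exI[of _ "F \<union> G"]) (auto simp: Sup_union_distrib intro: le_supI1 le_supI2)
qed

text \<open>Compactness gives a finite subfamily \<open>F\<close>, and closure under binary joins
  puts \<open>Sup F\<close> itself into \<open>S\<close>; \<open>bot \<in> S\<close> covers the case
  of empty \<open>F\<close>.\<close>

lemma compact_le_Sup_closed:
  assumes "c \<in> compacts" "c \<le> Sup S" "bot \<in> S"
    and "\<And>x y. x \<in> S \<Longrightarrow> y \<in> S \<Longrightarrow> sup x y \<in> S"
  obtains s where "s \<in> S" "c \<le> s"
proof -
  obtain F where F: "finite F" "F \<subseteq> S" "c \<le> Sup F"
    using assms(1,2) unfolding compacts_def compact_elt_def by blast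
  have "Sup F \<in> S" using F(1,2)
    by (induction F rule: finite_induct) (auto simp: assms)
  then show thesis using F(3) that by blast
qed

lemma algebraic_eq_Sup:
  fixes a :: "'a::complete_lattice"
  assumes "algebraic_lattice TYPE('a)"
  shows "a = Sup {c \<in> compacts. c \<le> a}"
proof (rule antisym)
  obtain S where S: "S \<subseteq> compacts" "a = Sup S"
    using assms unfolding algebraic_lattice_def by blast
  then have "S \<subseteq> {c \<in> compacts. c \<le> a}" by (auto intro: Sup_upper)
  then show "a \<le> Sup {c \<in> compacts. c \<le> a}" using S(2) by (metis Sup_subset_mono)
qed (auto intro: Sup_least)

text \<open>If all compact elements below \<open>a\<close> were below \<open>b\<close>, so would be
  their join \<open>a\<close>. This trades arbitrary witnesses for compact ones, to which the laws
  of \<open>lam\<close> apply.\<close>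

lemma compact_not_le:
  fixes a b :: "'a::complete_lattice"
  assumes "algebraic_lattice TYPE('a)" "\<not> a \<le> b"
  obtains c where "c \<in> compacts" "c \<le> a" "\<not> c \<le> b"
  using algebraic_eq_Sup[OF assms(1), of a] assms(2) Sup_least[of "{c \<in> compacts. c \<le> a}" b]
  by fastforce

lemma compact_le_quantale_O_iff:
  fixes p c :: "'a::comm_integral_quantale"
  assumes alg: "algebraic_lattice TYPE('a)" and p: "m_prime p" and c: "c \<in> compacts"
  shows "c \<le> quantale_O p \<longleftrightarrow> (\<exists>d\<in>compacts. \<not> d \<le> p \<and> c * d = bot)"
proof
  let ?S = "{u. \<exists>v. \<not> v \<le> p \<and> u * v = bot}"
  assume "c \<le> quantale_O p"
  then have "c \<le> Sup ?S" by (simp add: quantale_O_def)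
  \<comment> \<open>The witness is \<open>1\<close>, which is not below \<open>p\<close> because
    \<open>p < 1\<close>.\<close>
  moreover have "bot \<in> ?S"
    using p by (auto simp: m_prime_def less_le_not_le)
  moreover have "sup x y \<in> ?S" if x: "x \<in> ?S" and y: "y \<in> ?S" for x y
  proof -
    obtain v w where vw: "\<not> v \<le> p" "x * v = bot" "\<not> w \<le> p" "y * w = bot"
      using x y by blast
    \<comment> \<open>The product \<open>v * w\<close> annihilates both \<open>x\<close> and
      \<open>y\<close>, and primality keeps it from lying below \<open>p\<close>.\<close>
    have "sup x y * (v * w) = sup (x * v * w) (y * w * v)"
      using mult_sup_distrib[of "v * w" x y] by (simp add: ac_simps)
    then have "sup x y * (v * w) = bot" using vw by simp
    moreover have "\<not> v * w \<le> p" using p vw unfolding m_prime_def by blast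
    ultimately show ?thesis by blast
  qed
  ultimately obtain u where "u \<in> ?S" and cu: "c \<le> u"
    using compact_le_Sup_closed[OF c, of ?S] by blast
  then obtain v where v: "\<not> v \<le> p" "u * v = bot" by blast
  obtain d where d: "d \<in> compacts" "d \<le> v" "\<not> d \<le> p"
    using compact_not_le[OF alg v(1)] .
  have "c * d \<le> bot" using mult_mono_quantale[OF cu d(2)] v(2) by simp
  then show "\<exists>d\<in>compacts. \<not> d \<le> p \<and> c * d = bot" using d by (auto simp: bot_unique)
next
  assume "\<exists>d\<in>compacts. \<not> d \<le> p \<and> c * d = bot"
  then show "c \<le> quantale_O p" unfolding quantale_O_def by (auto intro!: Sup_upper)
qed

locale reticulated_quantale =
  fixes lam :: "'a::comm_integral_quantale \<Rightarrow> 'l::{distrib_lattice,bounded_lattice}"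
  assumes coherent: "coherent_quantale TYPE('a)"
    and reticulation: "reticulation lam"
begin

lemma alg: "algebraic_lattice TYPE('a)"
  and one_compact: "(1::'a) \<in> compacts"
  and mult_compact: "a \<in> compacts \<Longrightarrow> b \<in> compacts \<Longrightarrow> (a * b :: 'a) \<in> compacts"
  using coherent unfolding coherent_quantale_def by auto

lemma lam_mult: "a \<in> compacts \<Longrightarrow> b \<in> compacts \<Longrightarrow> lam (a * b) = inf (lam a) (lam b)"
  and lam_le_iff: "a \<in> compacts \<Longrightarrow> b \<in> compacts \<Longrightarrow> lam a \<le> lam b \<longleftrightarrow> (\<exists>n\<ge>1. a ^ n \<le> b)"
  and lam_sup_le: "a \<in> compacts \<Longrightarrow> b \<in> compacts \<Longrightarrow> lam (sup a b) \<le> sup (lam a) (lam b)"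
  using reticulation unfolding reticulation_def by auto

lemma lam_surj: obtains c where "c \<in> compacts" "x = lam c"
  using reticulation unfolding reticulation_def by (metis UNIV_I imageE)

lemma lam_mono: "a \<in> compacts \<Longrightarrow> b \<in> compacts \<Longrightarrow> a \<le> b \<Longrightarrow> lam a \<le> lam b"
  by (auto simp: lam_le_iff intro!: exI[of _ 1])

text \<open>By surjectivity \<open>bot\<close> is \<open>lam c\<close> for some compact
  \<open>c\<close>, and monotonicity puts \<open>lam bot\<close> below it. The dual argument gives
  \<open>lam_one\<close>.\<close>

lemma lam_bot: "lam bot = bot"
  by (metis lam_surj lam_mono bot_in_compacts bot_least bot_unique)

lemma lam_one: "lam 1 = top"
  by (metis lam_surj lam_mono one_compact one_eq_top top_greatest top_unique)

text \<open>If \<open>lam a\<close> is \<open>bot\<close>, then \<open>lam a \<le> lam bot\<close>,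
  so some power of \<open>a\<close> vanishes; semiprimeness then forces \<open>a\<close> to
  vanish.\<close>

lemma lam_eq_bot_iff:
  assumes "semiprime_quantale TYPE('a)" "a \<in> compacts"
  shows "lam a = bot \<longleftrightarrow> a = bot"
  using lam_le_iff[OF assms(2) bot_in_compacts] power_eq_bot_semiprime[OF assms(1), of _ a]
  by (auto simp: lam_bot bot_unique)

text \<open>Membership only gives some compact \<open>c \<le> p\<close> with the same image as
  \<open>d\<close>. Then a power of \<open>d\<close> lies below \<open>c\<close>, and primality of
  \<open>p\<close> removes the exponent.\<close>

lemma lam_mem_elt_to_ideal_iff:
  assumes "m_prime p" "d \<in> compacts"
  shows "lam d \<in> elt_to_ideal lam p \<longleftrightarrow> d \<le> p"
proof
  assume "lam d \<in> elt_to_ideal lam p"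
  then obtain c where c: "c \<in> compacts" "c \<le> p" "lam d = lam c"
    unfolding elt_to_ideal_def by auto
  then obtain n where "n \<ge> 1" "d ^ n \<le> c" using lam_le_iff[OF assms(2) c(1)] by auto
  then show "d \<le> p" using m_prime_power_le[OF assms(1)] c(2) by (meson order_trans)
qed (use assms in \<open>auto simp: elt_to_ideal_def\<close>)

text \<open>The compact elements with image in \<open>I\<close> are closed under binary joins, as
  \<open>lam\<close> is subadditive. So a compact element below their join lies below one of
  them.\<close>

lemma le_ideal_to_elt_iff:
  assumes I: "lattice_ideal I" and c: "c \<in> compacts"
  shows "c \<le> ideal_to_elt lam I \<longleftrightarrow> lam c \<in> I"
proof
  let ?S = "{c \<in> compacts. lam c \<in> I}"
  assume "c \<le> ideal_to_elt lam I"
  then have "c \<le> Sup ?S" by (simp add: ideal_to_elt_def)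
  moreover have "bot \<in> ?S" using I by (simp add: lam_bot bot_in_compacts lattice_ideal_def)
  moreover have "sup x y \<in> ?S" if "x \<in> ?S" "y \<in> ?S" for x y
    using that I lam_sup_le[of x y] sup_in_compacts[of x y] unfolding lattice_ideal_def by blast
  ultimately obtain s where "s \<in> ?S" "c \<le> s"
    using compact_le_Sup_closed[OF c, of ?S] by blast
  then show "lam c \<in> I" using I lam_mono[OF c, of s] unfolding lattice_ideal_def by blast
qed (use c in \<open>auto simp: ideal_to_elt_def intro: Sup_upper\<close>)

text \<open>A failure of primality would already occur at two compact elements, where
  \<open>lam\<close> turns the product into a meet and contradicts primality of
  \<open>P\<close>.\<close>

lemma m_prime_ideal_to_elt:
  assumes "prime_lattice_ideal P"
  shows "m_prime (ideal_to_elt lam P)"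
  unfolding m_prime_def
proof (intro conjI allI impI)
  let ?p = "ideal_to_elt lam P"
  have P: "lattice_ideal P" "P \<noteq> UNIV" "\<And>x y. inf x y \<in> P \<Longrightarrow> x \<in> P \<or> y \<in> P"
    using assms unfolding prime_lattice_ideal_def by auto
  have "top \<notin> P"
    using P(1,2) unfolding lattice_ideal_def by (metis UNIV_eq_I top_greatest)
  then have "\<not> 1 \<le> ?p" by (simp add: le_ideal_to_elt_iff[OF P(1) one_compact] lam_one)
  then show "?p < 1" by (metis one_eq_top top.not_eq_extremum top_greatest)
  fix a b assume ab: "a * b \<le> ?p"
  show "a \<le> ?p \<or> b \<le> ?p"
  proof (rule ccontr)
    assume "\<not> ?thesis"
    then obtain c d where c: "c \<in> compacts" "c \<le> a" "\<not> c \<le> ?p"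
      and d: "d \<in> compacts" "d \<le> b" "\<not> d \<le> ?p"
      using compact_not_le[OF alg] by metis
    have "c * d \<le> ?p" using mult_mono_quantale[OF c(2) d(2)] ab by (rule order_trans)
    then have "inf (lam c) (lam d) \<in> P"
      using le_ideal_to_elt_iff[OF P(1) mult_compact] lam_mult c(1) d(1) by metis
    then show False using P(3) c d le_ideal_to_elt_iff[OF P(1)] by blast
  qed
qed

text \<open>
  Covers both parts of the theorem: \<open>J\<close> is \<open>elt_to_ideal lam p\<close> in the first, and in the second
  \<open>J\<close> is a prime ideal with \<open>p = ideal_to_elt lam J\<close>.
\<close>
lemma lam_mem_lattice_O_iff:
  assumes semiprime: "semiprime_quantale TYPE('a)" and p: "m_prime p" and c: "c \<in> compacts"
    and J: "\<And>d. d \<in> compacts \<Longrightarrow> lam d \<in> J \<longleftrightarrow> d \<le> p"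
  shows "lam c \<in> lattice_O J \<longleftrightarrow> c \<le> quantale_O p"
proof -
  \<comment> \<open>By surjectivity, every witness \<open>y\<close> outside \<open>J\<close> is the
    image of a compact element.\<close>
  have "lam c \<in> lattice_O J \<longleftrightarrow> (\<exists>d\<in>compacts. lam d \<notin> J \<and> inf (lam c) (lam d) = bot)"
    unfolding lattice_O_def by (auto, metis lam_surj)
  also have "\<dots> \<longleftrightarrow> (\<exists>d\<in>compacts. \<not> d \<le> p \<and> c * d = bot)"
    using J lam_mult[OF c] lam_eq_bot_iff[OF semiprime mult_compact[OF c]] by auto
  also have "\<dots> \<longleftrightarrow> c \<le> quantale_O p"
    using compact_le_quantale_O_iff[OF alg p c] by simp
  finally show ?thesis .
qed

lemma lattice_O_elt_to_ideal:
  assumes "semiprime_quantale TYPE('a)" "m_prime p"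
  shows "lattice_O (elt_to_ideal lam p) = elt_to_ideal lam (quantale_O p)"
proof -
  have iff: "lam c \<in> lattice_O (elt_to_ideal lam p) \<longleftrightarrow> c \<le> quantale_O p" if "c \<in> compacts" for c
    using lam_mem_lattice_O_iff[OF assms that lam_mem_elt_to_ideal_iff[OF assms(2)]] .
  show ?thesis
  proof (intro set_eqI iffI)
    fix x assume x: "x \<in> lattice_O (elt_to_ideal lam p)"
    obtain c where "c \<in> compacts" "x = lam c" by (rule lam_surj)
    then show "x \<in> elt_to_ideal lam (quantale_O p)"
      using x iff unfolding elt_to_ideal_def by blast
  next
    fix x assume "x \<in> elt_to_ideal lam (quantale_O p)"
    then show "x \<in> lattice_O (elt_to_ideal lam p)"
      using iff by (auto simp: elt_to_ideal_def[of _ "quantale_O p"])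
  qed
qed

text \<open>Both sides are joins of the same compact elements: algebraicity writes the right-hand
  side as the join of all compact elements below it.\<close>

lemma ideal_to_elt_lattice_O:
  assumes "semiprime_quantale TYPE('a)" "prime_lattice_ideal P"
  shows "ideal_to_elt lam (lattice_O P) = quantale_O (ideal_to_elt lam P)"
proof -
  have P: "lattice_ideal P" using assms(2) by (simp add: prime_lattice_ideal_def)
  have "{c \<in> compacts. lam c \<in> lattice_O P} = {c \<in> compacts. c \<le> quantale_O (ideal_to_elt lam P)}"
    using lam_mem_lattice_O_iff[OF assms(1) m_prime_ideal_to_elt[OF assms(2)]]
      le_ideal_to_elt_iff[OF P] by blast
  then show ?thesis
    using algebraic_eq_Sup[OF alg] by (simp add: ideal_to_elt_def[of _ "lattice_O P"])
qed

end

theorem corollary4p20: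
  fixes lam :: "'a::comm_integral_quantale \<Rightarrow> 'l::{distrib_lattice,bounded_lattice}"
  assumes "coherent_quantale TYPE('a)"
    and "semiprime_quantale TYPE('a)"
    and "reticulation lam"
  shows "(\<forall>p\<in>Spec. lattice_O (elt_to_ideal lam p) = elt_to_ideal lam (quantale_O p)) \<and>
         (\<forall>P. prime_lattice_ideal P \<longrightarrow>
              ideal_to_elt lam (lattice_O P) = quantale_O (ideal_to_elt lam P))"
proof -
  interpret reticulated_quantale lam
    using assms(1,3) by unfold_locales
  show ?thesis
    using lattice_O_elt_to_ideal[OF assms(2)] ideal_to_elt_lattice_O[OF assms(2)]
    by (simp add: Spec_def)
qed

end
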